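(* Let $p,q$ be integers with $0<q<p$ and $\gcd(p,q)=1$. Then Algorithm A (described in the context), run on input $(p,q)$, is correct: it outputs a minimum $(p,q)$-mediated sequence.
   Context: Given an integer $p>0$, a set of nonnegative integers $A$ is a $p$-mediated sequence if every number in $A$ is the average of two distinct numbers in $A\cup\{0,p\}$. A $(p,q)$-mediated sequence is a $p$-mediated sequence containing $q$. A minimum $(p,q)$-mediated sequence is a $(p,q)$-mediated sequence of smallest cardinality. Algorithm A. Input: integers $p,q$ with $0<q<p$ and $\gcd(p,q)=1$. Set $l\leftarrow\lceil\log_2(p)\rceil$; $s_1\leftarrow q$, $s_2\leftarrow p-q$, $s_3\leftarrow 2^l-p$; $t_1\leftarrow p$, $t_2\leftarrow 0$, $t_3\leftarrow q$. For $k=1$ to $l$ do: find indices $i\neq j$ in $\{1,2,3\}$ such that $s_i\le s_j$ are both odd; set $q_k\leftarrow\frac{t_i+t_j}{2}$, then $t_i\leftarrow q_k$, and let $r$ be the remaining index in $\{1,2,3\}\setminus\{i,j\}$; set $s_j\leftarrow\frac{s_j-s_i}{2}$ and $s_r\leftarrow\frac{s_r}{2}$ (with $s_i$ and $t_j,t_r$ unchanged). Return $\{q_k\}_{k=1}^l$. *)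

theory Defs
  imports Complex_Main
begin

definition mediated_seq :: "int \<Rightarrow> int set \<Rightarrow> bool" where
  "mediated_seq p A \<longleftrightarrow>
     (\<forall>a\<in>A. 0 \<le> a) \<and>
     (\<forall>a\<in>A. \<exists>b\<in>A \<union> {0, p}. \<exists>c\<in>A \<union> {0, p}.
        b \<noteq> c \<and> rat_of_int a = (rat_of_int b + rat_of_int c) / 2)"

definition mediated_seq_containing :: "int \<Rightarrow> int \<Rightarrow> int set \<Rightarrow> bool" where
  "mediated_seq_containing p q A \<longleftrightarrow> mediated_seq p A \<and> q \<in> A"

text \<open>
  Infinite mediated sequences exist (all positive integers, for instance), and \<open>card\<close> is 0 on
  infinite sets. So a minimum is required to be finite and is compared with finite competitors
  only; an infinite competitor is larger than any finite set.
\<close>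

definition minimum_mediated_seq :: "int \<Rightarrow> int \<Rightarrow> int set \<Rightarrow> bool" where
  "minimum_mediated_seq p q A \<longleftrightarrow>
     mediated_seq_containing p q A \<and> finite A \<and>
     (\<forall>B. mediated_seq_containing p q B \<and> finite B \<longrightarrow> card A \<le> card B)"

text \<open>
  The registers \<open>s\<close>, \<open>t\<close> of Algorithm A hold rational numbers, so that all divisions by 2 are
  genuine divisions: that no fractions arise is part of the correctness of the algorithm.
  Only the values at the indices 1, 2, 3 matter.
\<close>

type_synonym state = "(nat \<Rightarrow> rat) \<times> (nat \<Rightarrow> rat)"

definition odd_integer :: "rat \<Rightarrow> bool" where
  "odd_integer x \<longleftrightarrow> (\<exists>n::int. odd n \<and> x = of_int n)"

definition num_iterations :: "int \<Rightarrow> nat" where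
  "num_iterations p = nat \<lceil>log 2 (real_of_int p)\<rceil>"

definition init_state :: "int \<Rightarrow> int \<Rightarrow> state" where
  "init_state p q =
     ((\<lambda>_. 0)(1 := of_int q, 2 := of_int (p - q), 3 := 2 ^ num_iterations p - of_int p),
      (\<lambda>_. 0)(1 := of_int p, 2 := 0, 3 := of_int q))"

text \<open>
  \<open>iteration \<sigma> x \<sigma>'\<close>: one pass through the loop body from \<open>\<sigma>\<close> to \<open>\<sigma>'\<close> that outputs \<open>x\<close>.
  It is a relation because the choice of \<open>i\<close>, \<open>j\<close> is not unique when \<open>s i = s j\<close>, and because a
  suitable pair has to be shown to exist.
\<close>

inductive iteration :: "state \<Rightarrow> rat \<Rightarrow> state \<Rightarrow> bool" where
  "\<lbrakk>{i, j, r} = {1, 2, 3}; i \<noteq> j; odd_integer (s i); odd_integer (s j); s i \<le> s j;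
    x = (t i + t j) / 2\<rbrakk>
   \<Longrightarrow> iteration (s, t) x (s(j := (s j - s i) / 2, r := s r / 2), t(i := x))"

text \<open>
  \<open>partial_run p q xs \<sigma>\<close>: some execution on input \<open>(p, q)\<close> is in state \<open>\<sigma>\<close> after
  \<open>length xs\<close> iterations, in which it has produced the numbers \<open>xs\<close> in this order.
\<close>

inductive partial_run :: "int \<Rightarrow> int \<Rightarrow> rat list \<Rightarrow> state \<Rightarrow> bool" for p q where
  start: "partial_run p q [] (init_state p q)"
| iterate: "\<lbrakk>partial_run p q xs \<sigma>; length xs < num_iterations p; iteration \<sigma> x \<sigma>'\<rbrakk>
    \<Longrightarrow> partial_run p q (xs @ [x]) \<sigma>'"

definition returns :: "int \<Rightarrow> int \<Rightarrow> rat set \<Rightarrow> bool" where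
  "returns p q Q \<longleftrightarrow>
     (\<exists>xs \<sigma>. partial_run p q xs \<sigma> \<and> length xs = num_iterations p \<and> Q = set xs)"

text \<open>
  Total correctness: no execution gets stuck before the last iteration, whatever choices are
  made, and every returned set is a minimum \<open>(p, q)\<close>-mediated sequence.
\<close>

definition algorithm_correct :: "int \<Rightarrow> int \<Rightarrow> bool" where
  "algorithm_correct p q \<longleftrightarrow>
     (\<forall>xs \<sigma>. partial_run p q xs \<sigma> \<and> length xs < num_iterations p \<longrightarrow>
        (\<exists>x \<sigma>'. iteration \<sigma> x \<sigma>')) \<and>
     (\<exists>Q. returns p q Q) \<and>
     (\<forall>Q. returns p q Q \<longrightarrow> (\<exists>A. Q = rat_of_int ` A \<and> minimum_mediated_seq p q A))"

end

theory Submission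
  imports Defs "HOL-Library.Multiset" "HOL-Number_Theory.Cong"
begin

text \<open>
  Optimality comes from the bound \<open>p \<le> 2 ^ card A\<close> for every finite \<open>(p, q)\<close>-mediated sequence \<open>A\<close>
  with \<open>p\<close> and \<open>q\<close> coprime (\<open>mediated_seq_card_bound\<close>). Put \<open>m\<close> chips on \<open>q\<close>. As long as
  some \<open>a \<in> A\<close> carries two chips, move them to the two distinct numbers whose average is \<open>a\<close>. The
  sum of the positions stays \<open>m * q\<close> while the sum of their squares grows, so the process stops;
  then the chips on \<open>A\<close> form a subset of \<open>A\<close>, and the other chips lie on \<open>0\<close> and \<open>p\<close>. Hence, modulo
  \<open>p\<close>, every multiple of \<open>q\<close> is the sum of a subset of \<open>A\<close>. These multiples exhaust the \<open>p\<close> residue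
  classes, so \<open>A\<close> has at least \<open>p\<close> subsets.

  For the algorithm, read \<open>s\<close> as weights on the points \<open>t\<close>. With \<open>e\<close> iterations left, the weights
  have sum \<open>2 ^ e\<close> and the weighted average of the points is \<open>q\<close>; both facts survive an iteration. The
  weights stay jointly coprime, and so do the differences of the points. By parity, exactly two
  weights are odd while \<open>e > 0\<close>, and then the two points involved have an integral average. When
  \<open>e = 0\<close>, all the weight sits on one point, which is therefore \<open>q\<close>.

  What remains is that the two averaged points are distinct. Two points can only collide at \<open>q\<close>
  (\<open>balanced_collision\<close>), so the first collision would be caused by an output equal to \<open>q\<close>. But an
  output equal to \<open>q\<close> completes a \<open>(p, q)\<close>-mediated sequence, and by the lower bound this cannot
  happen before the last iteration. The same bound shows that the result is minimum.
\<close>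

section \<open>The lower bound on the cardinality\<close>

lemma mediated_seq_int_iff:
  "mediated_seq p A \<longleftrightarrow>
     (\<forall>a\<in>A. 0 \<le> a \<and> (\<exists>b\<in>A \<union> {0, p}. \<exists>c\<in>A \<union> {0, p}. b \<noteq> c \<and> 2 * a = b + c))"
proof -
  have eq: "rat_of_int a = (rat_of_int b + rat_of_int c) / 2 \<longleftrightarrow> 2 * a = b + c" for a b c
  proof -
    have "rat_of_int a = (rat_of_int b + rat_of_int c) / 2
        \<longleftrightarrow> rat_of_int (2 * a) = rat_of_int (b + c)"
      by (auto simp: field_simps)
    then show ?thesis
      by (simp only: of_int_eq_iff)
  qed
  show ?thesis
    unfolding mediated_seq_def eq by blast
qed

lemma sum_squares_le_size_bound:
  fixes M :: "int multiset"
  assumes "\<And>x. x \<in># M \<Longrightarrow> x\<^sup>2 \<le> K"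
  shows "(\<Sum>x\<in>#M. x\<^sup>2) \<le> int (size M) * K"
  using assms by (induction M) (auto simp: algebra_simps intro: add_mono)

text \<open>
  A multiset of size \<open>m\<close> describes the positions of \<open>m\<close> chips. Instead of running the chip-moving
  process until it stops, take a reachable configuration whose sum of squares is largest: a number of
  \<open>A\<close> carrying two chips could be used to increase that sum further.
\<close>

lemma stable_chips:
  assumes fin: "finite A" and med: "mediated_seq p A" and q: "q \<in> A"
  obtains M where "set_mset M \<subseteq> A \<union> {0, p}" "sum_mset M = int m * q"
    "\<And>a. a \<in> A \<Longrightarrow> count M a \<le> 1"
proof -
  define P where
    "P M \<longleftrightarrow> set_mset M \<subseteq> A \<union> {0, p} \<and> size M = m \<and> sum_mset M = int m * q" for M
  define E where "E M = (\<Sum>x\<in>#M. x\<^sup>2)" for M :: "int multiset"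
  define K where "K = Max ((\<lambda>x. x\<^sup>2) ` (A \<union> {0, p}))"
  have init: "P (replicate_mset m q)"
    using q by (auto simp: P_def)
  have bound: "nat (E M) \<le> nat (int m * K)" if "P M" for M
  proof -
    have "x\<^sup>2 \<le> K" if "x \<in># M" for x
      using fin that \<open>P M\<close> unfolding K_def P_def by (intro Max_ge) auto
    then show ?thesis
      using sum_squares_le_size_bound[of M K] \<open>P M\<close> by (auto simp: P_def E_def)
  qed
  have "\<exists>M. P M \<and> (\<forall>N. P N \<longrightarrow> nat (E N) \<le> nat (E M))"
    using init bound
    by (intro ex_has_greatest_nat[where b = "Suc (nat (int m * K))"]) (auto simp only: less_Suc_eq_le)
  then obtain M where M: "P M" and max: "\<And>N. P N \<Longrightarrow> nat (E N) \<le> nat (E M)"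
    by blast
  have E_nonneg: "0 \<le> E N" for N
    unfolding E_def by (induction N) auto
  \<comment> \<open>Replacing \<open>a, a\<close> by \<open>b, c\<close> with \<open>2 * a = b + c\<close> raises the sum of squares by \<open>(b - c)\<^sup>2 / 2\<close>.\<close>
  have "count M a \<le> 1" if "a \<in> A" for a
  proof (rule ccontr)
    assume "\<not> count M a \<le> 1"
    then have "{#a, a#} \<subseteq># M"
      by (auto simp: subseteq_mset_def)
    then obtain N where N: "M = {#a, a#} + N"
      using mset_subset_eq_exists_conv by metis
    obtain b c where bc: "b \<in> A \<union> {0, p}" "c \<in> A \<union> {0, p}" "b \<noteq> c" "2 * a = b + c"
      using med \<open>a \<in> A\<close> unfolding mediated_seq_int_iff by blast
    have "P ({#b, c#} + N)"
      using M bc unfolding P_def N by auto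
    from max[OF this] have "E ({#b, c#} + N) \<le> E M"
      using E_nonneg[of "{#b, c#} + N"] E_nonneg[of M] by linarith
    then have "b\<^sup>2 + c\<^sup>2 \<le> 2 * a\<^sup>2"
      by (simp add: E_def N)
    moreover have "2 * (b\<^sup>2 + c\<^sup>2) = (2 * a)\<^sup>2 + (b - c)\<^sup>2"
      unfolding bc(4) by (simp add: power2_eq_square algebra_simps)
    moreover have "(b - c)\<^sup>2 > 0"
      using bc(3) by simp
    ultimately show False
      by (simp add: power_mult_distrib)
  qed
  with that M show thesis
    unfolding P_def by blast
qed

lemma dvd_sum_mset:
  fixes p :: "'a :: comm_semiring_1"
  assumes "\<And>x. x \<in># N \<Longrightarrow> p dvd x"
  shows "p dvd \<Sum>\<^sub># N"
  using assms by (induction N) auto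

lemma subset_sum_multiple:
  assumes "finite A" and "mediated_seq p A" and "q \<in> A"
  shows "\<exists>S\<subseteq>A. [\<Sum>S = int m * q] (mod p)"
proof -
  obtain M where M: "set_mset M \<subseteq> A \<union> {0, p}" "sum_mset M = int m * q"
    "\<And>a. a \<in> A \<Longrightarrow> count M a \<le> 1"
    using stable_chips[OF assms] by blast
  define S where "S = set_mset M \<inter> A"
  have "finite S"
    by (simp add: S_def)
  have inner: "{#x \<in># M. x \<in> A#} = mset_set S"
  proof (rule multiset_eqI)
    fix x
    show "count {#x \<in># M. x \<in> A#} x = count (mset_set S) x"
      using M(3)[of x] \<open>finite S\<close>
      by (auto simp: S_def count_eq_zero_iff le_Suc_eq count_mset_set')
  qed
  have "p dvd x" if "x \<in># {#x \<in># M. x \<notin> A#}" for x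
    using that M(1) by auto
  then have outer: "p dvd \<Sum>\<^sub># {#x \<in># M. x \<notin> A#}"
    by (rule dvd_sum_mset)
  have "\<Sum>\<^sub># M = \<Sum>S + \<Sum>\<^sub># {#x \<in># M. x \<notin> A#}"
    using multiset_partition[of M "\<lambda>x. x \<in> A"] inner
    by (metis sum_mset.union sum_unfold_sum_mset multiset.map_ident)
  then have "[\<Sum>S = int m * q] (mod p)"
    using M(2) outer by (simp add: cong_iff_dvd_diff dvd_diff_commute[of p "\<Sum>S"])
  then show ?thesis
    by (auto simp: S_def)
qed

text \<open>
  The multiples \<open>0 * q, \<dots>, (p - 1) * q\<close> are pairwise incongruent modulo \<open>p\<close>, so the subsets of \<open>A\<close>
  that represent them are pairwise distinct.
\<close>

lemma mediated_seq_card_bound: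
  assumes "finite A" and "mediated_seq_containing p q A" and "coprime p q"
  shows "p \<le> 2 ^ card A"
proof -
  have "\<forall>m. \<exists>S\<subseteq>A. [\<Sum>S = int m * q] (mod p)"
    using subset_sum_multiple[of A p q] assms by (simp add: mediated_seq_containing_def)
  then obtain S where S: "\<And>m. S m \<subseteq> A" "\<And>m. [\<Sum>(S m) = int m * q] (mod p)"
    by metis
  have "inj_on S {..<nat p}"
  proof (rule inj_onI)
    fix m n assume mn: "m \<in> {..<nat p}" "n \<in> {..<nat p}" "S m = S n"
    then have "[int m * q = int n * q] (mod p)"
      using S(2)[of m] S(2)[of n] by (metis cong_sym cong_trans)
    then have "[int m = int n] (mod p)"
      using assms(3) by (simp add: cong_mult_rcancel coprime_commute)
    with mn show "m = n"
      by (auto simp: cong_def)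
  qed
  then have "card {..<nat p} \<le> card (Pow A)"
    using S(1) assms(1) by (intro card_inj_on_le[of S]) auto
  then have "nat p \<le> 2 ^ card A"
    by (simp add: card_Pow assms(1))
  then show ?thesis
    by (simp add: nat_le_iff)
qed

lemma num_iterations_le_iff:
  assumes "0 < p"
  shows "num_iterations p \<le> n \<longleftrightarrow> p \<le> 2 ^ n"
proof -
  have "num_iterations p \<le> n \<longleftrightarrow> log 2 (real_of_int p) \<le> real n"
    by (simp add: num_iterations_def ceiling_le_iff)
  also have "\<dots> \<longleftrightarrow> real_of_int p \<le> 2 ^ n"
    using assms by (simp add: log_le_iff powr_realpow)
  also have "\<dots> \<longleftrightarrow> real_of_int p \<le> real_of_int (2 ^ n)"
    by simp
  also have "\<dots> \<longleftrightarrow> p \<le> 2 ^ n"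
    by (simp only: of_int_le_iff)
  finally show ?thesis .
qed

section \<open>Three weighted integer points with average q\<close>

text \<open>
  The two divisibility clauses say that the weights \<open>S\<close>, and the differences of the points \<open>T\<close>, have
  greatest common divisor 1. The first guarantees two odd weights at every stage; the second limits
  how points can collide.
\<close>

definition balanced :: "int \<Rightarrow> nat \<Rightarrow> (nat \<Rightarrow> int) \<Rightarrow> (nat \<Rightarrow> int) \<Rightarrow> bool" where
  "balanced q e S T \<longleftrightarrow>
     (\<forall>k\<in>{1, 2, 3}. 0 \<le> S k) \<and>
     (\<Sum>k\<in>{1, 2, 3}. S k) = 2 ^ e \<and>
     (\<Sum>k\<in>{1, 2, 3}. S k * T k) = 2 ^ e * q \<and>
     (\<forall>d. (\<forall>k\<in>{1, 2, 3}. d dvd S k) \<longrightarrow> is_unit d) \<and>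
     (\<forall>d. (\<forall>k\<in>{1, 2, 3}. \<forall>m\<in>{1, 2, 3}. d dvd T k - T m) \<longrightarrow> is_unit d)"

lemma index_triple_distinct:
  assumes "{i, j, r} = {1, 2, 3 :: nat}"
  shows "i \<noteq> j" "j \<noteq> r" "i \<noteq> r"
proof -
  have "card {i, j, r} = 3"
    unfolding assms by simp
  then show "i \<noteq> j" "j \<noteq> r" "i \<noteq> r"
    by (auto simp: card_insert_if split: if_splits)
qed

text \<open>
  Spelling the conditions out along an arbitrary enumeration \<open>i, j, r\<close> of the three indices makes all
  choices of indices in an iteration equivalent, without a case distinction.
\<close>

lemma balanced_iff:
  assumes "{i, j, r} = {1, 2, 3}"
  shows "balanced q e S T \<longleftrightarrow>
     0 \<le> S i \<and> 0 \<le> S j \<and> 0 \<le> S r \<and>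
     S i + S j + S r = 2 ^ e \<and>
     S i * T i + S j * T j + S r * T r = 2 ^ e * q \<and>
     (\<forall>d. d dvd S i \<and> d dvd S j \<and> d dvd S r \<longrightarrow> is_unit d) \<and>
     (\<forall>d. d dvd T i - T j \<and> d dvd T r - T j \<longrightarrow> is_unit d)"
proof -
  note ne = index_triple_distinct[OF assms]
  have "(\<forall>k\<in>{i, j, r}. \<forall>m\<in>{i, j, r}. d dvd T k - T m)
      \<longleftrightarrow> d dvd T i - T j \<and> d dvd T r - T j" for d
  proof -
    have "d dvd T i - T r" if "d dvd T i - T j" "d dvd T r - T j"
      using dvd_diff[OF that] by simp
    then show ?thesis
      by (auto simp: dvd_diff_commute[of d "T j"] dvd_diff_commute[of d "T r" "T i"])
  qed
  then show ?thesis
    unfolding balanced_def assms[symmetric] using ne by (simp add: add.assoc)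
qed

text \<open>
  The weights are not all even, being coprime, and their sum \<open>2 ^ Suc e\<close> is even; so exactly
  two of them are odd.
\<close>

lemma balanced_odd_pair:
  assumes "balanced q (Suc e) S T"
  obtains i j r where "{i, j, r} = {1, 2, 3}" "odd (S i)" "odd (S j)" "S i \<le> S j"
proof -
  have "\<not> (\<forall>k\<in>{1, 2, 3}. 2 dvd S k)"
    using assms unfolding balanced_def by (metis odd_one)
  then obtain i where i: "i \<in> {1, 2, 3}" "odd (S i)"
    by blast
  have "\<exists>j r. {i, j, r} = {1, 2, 3}"
    using i(1) by auto
  then obtain j r where ijr: "{i, j, r} = {1, 2, 3}"
    by blast
  have "S i + S j + S r = 2 * 2 ^ e"
    using assms by (simp add: balanced_iff[OF ijr])
  then have "even (S i + S j + S r)"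
    by simp
  with i(2) have "odd (S j) \<or> odd (S r)"
    by auto
  then obtain j' r' where ijr': "{i, j', r'} = {1, 2, 3}" and j': "odd (S j')"
    using ijr by (metis insert_commute)
  show thesis
  proof (cases "S i \<le> S j'")
    case True
    with that i(2) j' ijr' show thesis
      by blast
  next
    case False
    with that[of j' i r'] i(2) j' ijr' show thesis
      by (simp add: insert_commute)
  qed
qed

text \<open>
  First halve all weights; then merge the weight \<open>S i / 2\<close> at \<open>T i\<close> with an equal weight taken from
  \<open>T j\<close> into the weight \<open>S i\<close> at their midpoint. Merging changes neither the total weight nor the
  weighted sum, so both are just halved by an iteration. A common divisor of the
  new weights divides the old ones, and a common divisor of the new differences divides the old ones.
  Modulo 2, the weighted sum is \<open>T i + T j\<close>, which is why that number is even.
\<close>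

lemma balanced_step:
  assumes bal: "balanced q (Suc e) S T" and ijr: "{i, j, r} = {1, 2, 3}"
    and odd: "odd (S i)" "odd (S j)" and le: "S i \<le> S j"
  shows "even (T i + T j)" "even (S r)"
    "balanced q e (S(j := (S j - S i) div 2, r := S r div 2)) (T(i := (T i + T j) div 2))"
proof -
  note ne = index_triple_distinct[OF ijr]
  have nonneg: "0 \<le> S i" "0 \<le> S j" "0 \<le> S r"
    and total: "S i + S j + S r = 2 * 2 ^ e"
    and mean: "S i * T i + S j * T j + S r * T r = 2 * 2 ^ e * q"
    and cop: "\<And>d. d dvd S i \<Longrightarrow> d dvd S j \<Longrightarrow> d dvd S r \<Longrightarrow> is_unit d"
    and diff: "\<And>d. d dvd T i - T j \<Longrightarrow> d dvd T r - T j \<Longrightarrow> is_unit d"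
    using bal unfolding balanced_iff[OF ijr] by auto
  have "even (S i + S j + S r)"
    unfolding total by simp
  with odd show evr: "even (S r)"
    by simp
  have "even (S i * T i + S j * T j + S r * T r)"
    unfolding mean by simp
  with odd evr show evt: "even (T i + T j)"
    by simp
  obtain x where x: "T i + T j = 2 * x"
    using evt by blast
  obtain u where u: "S j - S i = 2 * u"
  proof -
    have "even (S j - S i)"
      using odd by simp
    then show thesis
      using that by blast
  qed
  obtain v where v: "S r = 2 * v"
    using evr by blast
  have "2 * (S i * x + u * T j + v * T r)
      = S i * (2 * x) + (2 * u) * T j + (2 * v) * T r"
    by (simp add: algebra_simps)
  also have "\<dots> = 2 * (2 ^ e * q)"
    unfolding x[symmetric] u[symmetric] v[symmetric] using mean by (simp add: algebra_simps)
  finally have mean': "S i * x + u * T j + v * T r = 2 ^ e * q"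
    by simp
  have cop': "is_unit d" if "d dvd S i" "d dvd u" "d dvd v" for d
  proof (rule cop)
    have "S j = S i + 2 * u"
      using u by simp
    with that show "d dvd S j"
      by simp
  qed (use that v in auto)
  have diff': "is_unit d" if "d dvd x - T j" "d dvd T r - T j" for d
  proof (rule diff)
    have "T i - T j = 2 * (x - T j)"
      using x by simp
    then show "d dvd T i - T j"
      using that(1) by (simp only: dvd_mult)
  qed (rule that(2))
  have "S i + u + v = 2 ^ e"
    using total u v by simp
  then show "balanced q e (S(j := (S j - S i) div 2, r := S r div 2)) (T(i := (T i + T j) div 2))"
    using ne nonneg le mean' cop' diff' u v x unfolding balanced_iff[OF ijr]
    by (auto)
qed

text \<open>
  If \<open>T i = T r\<close>, the differences are generated by \<open>T j - T i\<close>, which is therefore \<open>1\<close> or \<open>-1\<close>. Measured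
  from \<open>T i\<close>, the weighted sum is then \<open>S j\<close> up to sign, so \<open>2 ^ e\<close> divides \<open>S j\<close>. Since \<open>S i > 0\<close> leaves
  less than \<open>2 ^ e\<close> for \<open>S j\<close>, no weight sits on \<open>T j\<close>, and the average \<open>q\<close> is the common point.
\<close>

lemma balanced_collision:
  assumes bal: "balanced q e S T" and ijr: "{i, j, r} = {1, 2, 3}"
    and pos: "0 < S i" and eq: "T i = T r"
  shows "T i = q"
proof -
  have nonneg: "0 \<le> S j" "0 \<le> S r"
    and total: "S i + S j + S r = 2 ^ e"
    and mean: "S i * T i + S j * T j + S r * T r = 2 ^ e * q"
    and diff: "\<And>d. d dvd T i - T j \<Longrightarrow> d dvd T r - T j \<Longrightarrow> is_unit d"
    using bal unfolding balanced_iff[OF ijr] by auto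
  have unit: "T j - T i = 1 \<or> T j - T i = - 1"
    using diff[of "T i - T j"] eq by auto
  have "S j * (T j - T i) = (S i * T i + S j * T j + S r * T r) - (S i + S j + S r) * T i"
    using eq by (simp add: algebra_simps)
  also have "\<dots> = 2 ^ e * (q - T i)"
    unfolding total mean by (simp add: algebra_simps)
  finally have *: "S j * (T j - T i) = 2 ^ e * (q - T i)" .
  then have "2 ^ e dvd S j * (T j - T i)"
    by simp
  then have "2 ^ e dvd S j"
    using unit by (elim disjE) simp_all
  moreover have "S j < 2 ^ e"
    using pos nonneg total by linarith
  ultimately have "S j = 0"
    using nonneg zdvd_not_zless[of "S j" "2 ^ e"] by linarith
  with * show ?thesis
    by simp
qed

lemma balanced_final:
  assumes bal: "balanced q 0 S T" and i: "i \<in> {1, 2, 3}" and pos: "0 < S i"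
  shows "T i = q"
proof -
  have "\<exists>j r. {i, j, r} = {1, 2, 3}"
    using i by auto
  then obtain j r where ijr: "{i, j, r} = {1, 2, 3}"
    by blast
  then have "0 \<le> S j" "0 \<le> S r" "S i + S j + S r = 1" and
    mean: "S i * T i + S j * T j + S r * T r = q"
    using bal by (auto simp: balanced_iff[OF ijr])
  then have "S i = 1" "S j = 0" "S r = 0"
    using pos by auto
  with mean show ?thesis
    by simp
qed

section \<open>The invariant of the algorithm\<close>

text \<open>
  The register \<open>t\<^sub>3\<close> starts as \<open>q\<close>, so early outputs may be averages that involve \<open>q\<close> although \<open>q\<close>
  itself has not been produced yet.
\<close>

definition mediated_modulo :: "int \<Rightarrow> int \<Rightarrow> int set \<Rightarrow> bool" where
  "mediated_modulo p q A \<longleftrightarrow> (\<forall>a\<in>A. 0 \<le> a \<and>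
     (\<exists>b\<in>A \<union> {0, p, q}. \<exists>c\<in>A \<union> {0, p, q}. b \<noteq> c \<and> 2 * a = b + c))"

lemma mediated_moduloD:
  assumes "mediated_modulo p q A" and "q \<in> A"
  shows "mediated_seq_containing p q A"
proof -
  have "A \<union> {0, p, q} = A \<union> {0, p}"
    using assms(2) by auto
  with assms show ?thesis
    unfolding mediated_modulo_def mediated_seq_containing_def mediated_seq_int_iff by metis
qed

lemma mediated_modulo_insert:
  assumes "mediated_modulo p q A" and "0 \<le> p" "0 \<le> q"
    and "b \<in> A \<union> {0, p, q}" "c \<in> A \<union> {0, p, q}" "b \<noteq> c" "2 * a = b + c"
  shows "mediated_modulo p q (insert a A)"
proof -
  have "0 \<le> b" "0 \<le> c"
    using assms by (auto simp: mediated_modulo_def)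
  then have "0 \<le> a"
    using assms(7) by linarith
  then show ?thesis
    using assms unfolding mediated_modulo_def by blast
qed

text \<open>
  \<open>ys\<close> lists the outputs so far, and \<open>S\<close>, \<open>T\<close> are the contents of the registers. After the last
  iteration distinctness of the points may fail: there \<open>q\<close> has been produced, possibly next to the
  initial \<open>q\<close> in the third register.
\<close>

definition invariant :: "int \<Rightarrow> int \<Rightarrow> int list \<Rightarrow> (nat \<Rightarrow> int) \<Rightarrow> (nat \<Rightarrow> int) \<Rightarrow> bool" where
  "invariant p q ys S T \<longleftrightarrow>
     length ys \<le> num_iterations p \<and>
     balanced q (num_iterations p - length ys) S T \<and>
     mediated_modulo p q (set ys) \<and>
     T ` {1, 2, 3} \<subseteq> set ys \<union> {0, p, q} \<and>
     (length ys < num_iterations p \<longrightarrow> inj_on T {1, 2, 3}) \<and>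
     (length ys = num_iterations p \<longrightarrow> q \<in> set ys)"

definition represents :: "state \<Rightarrow> (nat \<Rightarrow> int) \<Rightarrow> (nat \<Rightarrow> int) \<Rightarrow> bool" where
  "represents \<sigma> S T \<longleftrightarrow>
     (\<forall>k\<in>{1, 2, 3}. fst \<sigma> k = of_int (S k) \<and> snd \<sigma> k = of_int (T k))"

lemma odd_integer_of_int [simp]: "odd_integer (of_int n) \<longleftrightarrow> odd n"
  by (auto simp: odd_integer_def)

text \<open>
  The new output \<open>x\<close> differs from \<open>q\<close> except at the end, since otherwise the outputs so far would form
  a \<open>(p, q)\<close>-mediated sequence with fewer than \<open>\<lceil>log 2 p\<rceil>\<close> elements. By \<open>balanced_collision\<close> this
  keeps the points distinct, and hence the next average is again one of two distinct numbers. In the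
  last iteration \<open>x\<close> is a point of positive weight, so it is \<open>q\<close>.
\<close>

lemma invariant_step:
  assumes inv: "invariant p q ys S T" and pq: "0 < q" "q < p" "coprime p q"
    and len: "length ys < num_iterations p" and ijr: "{i, j, r} = {1, 2, 3}"
    and odd: "odd (S i)" "odd (S j)" and le: "S i \<le> S j"
  shows "invariant p q (ys @ [(T i + T j) div 2])
    (S(j := (S j - S i) div 2, r := S r div 2)) (T(i := (T i + T j) div 2))"
proof -
  define x where "x = (T i + T j) div 2"
  define S' where "S' = S(j := (S j - S i) div 2, r := S r div 2)"
  define T' where "T' = T(i := x)"
  define e where "e = num_iterations p - length (ys @ [x])"
  note ne = index_triple_distinct[OF ijr]
  have e: "num_iterations p - length ys = Suc e"
    using len by (simp add: e_def)
  have bal: "balanced q (Suc e) S T" and med: "mediated_modulo p q (set ys)"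
    and mem: "T ` {1, 2, 3} \<subseteq> set ys \<union> {0, p, q}" and inj: "inj_on T {1, 2, 3}"
    using inv len unfolding invariant_def e by auto
  note step = balanced_step[OF bal ijr odd le]
  have bal': "balanced q e S' T'"
    using step(3) unfolding S'_def T'_def x_def .
  have x: "2 * x = T i + T j"
    using step(1) by (simp add: x_def)
  have "0 \<le> S i"
    using bal unfolding balanced_iff[OF ijr] by blast
  with odd(1) have "0 < S i"
    by (cases "S i = 0") auto
  then have pos: "0 < S' i"
    using ne by (simp add: S'_def)
  have T'i: "T' i = x" "T' j = T j" "T' r = T r"
    using ne by (simp_all add: T'_def)
  have idx: "i \<in> {1, 2, 3}" "j \<in> {1, 2, 3}" "r \<in> {1, 2, 3}"
    using ijr by blast+
  have dist: "T i \<noteq> T j" "T j \<noteq> T r"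
    using inj idx ne by (auto dest: inj_onD)
  have memij: "T i \<in> set ys \<union> {0, p, q}" "T j \<in> set ys \<union> {0, p, q}"
    using mem idx by blast+
  have med': "mediated_modulo p q (set (ys @ [x]))"
    using mediated_modulo_insert[OF med _ _ memij dist(1) x] pq by simp
  have early: "x \<noteq> q" if "length (ys @ [x]) < num_iterations p"
  proof
    assume "x = q"
    then have "mediated_seq_containing p q (set (ys @ [x]))"
      using med' by (intro mediated_moduloD) auto
    then have "p \<le> 2 ^ card (set (ys @ [x]))"
      using pq by (intro mediated_seq_card_bound) auto
    then have "num_iterations p \<le> card (set (ys @ [x]))"
      using pq by (simp add: num_iterations_le_iff)
    then show False
      using that card_length[of "ys @ [x]"] by linarith
  qed
  have "inj_on T' {1, 2, 3}" if "length (ys @ [x]) < num_iterations p"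
  proof -
    have "x \<noteq> T r"
      using balanced_collision[OF bal' ijr pos] early[OF that] T'i by auto
    moreover have "x \<noteq> T j"
      using x dist(1) by auto
    ultimately show ?thesis
      unfolding ijr[symmetric] inj_on_def using T'i dist ne by auto
  qed
  moreover have "q \<in> set (ys @ [x])" if "length (ys @ [x]) = num_iterations p"
  proof -
    have "e = 0"
      using that by (simp add: e_def)
    then have "x = q"
      using balanced_final[of q S' T' i] bal' idx(1) pos T'i(1) by simp
    then show ?thesis
      by simp
  qed
  moreover have "T' ` {1, 2, 3} \<subseteq> set (ys @ [x]) \<union> {0, p, q}"
    using mem by (auto simp: T'_def)
  ultimately have "invariant p q (ys @ [x]) S' T'"
    using bal' med' len unfolding invariant_def e_def by auto
  then show ?thesis
    unfolding S'_def T'_def x_def .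
qed

lemma invariant_init:
  assumes "0 < q" "q < p" "coprime p q"
  shows "\<exists>S T. represents (init_state p q) S T \<and> invariant p q [] S T"
proof -
  define l where "l = num_iterations p"
  define S :: "nat \<Rightarrow> int" where "S = (\<lambda>_. 0)(1 := q, 2 := p - q, 3 := 2 ^ l - p)"
  define T :: "nat \<Rightarrow> int" where "T = (\<lambda>_. 0)(1 := p, 2 := 0, 3 := q)"
  have "p \<le> 2 ^ l"
    using num_iterations_le_iff[of p l] assms by (simp add: l_def)
  moreover have "is_unit d" if "d dvd q" "d dvd p - q" for d
  proof -
    have "d dvd p"
      using dvd_add[OF that] by simp
    with that assms(3) show ?thesis
      using coprime_common_divisor by blast
  qed
  moreover have "is_unit d" if "d dvd p" "d dvd q" for d
    using that assms(3) coprime_common_divisor by blast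
  ultimately have "balanced q l S T"
    using assms unfolding balanced_iff[OF refl]
    by (auto simp: S_def T_def algebra_simps)
  moreover have "0 < l"
  proof -
    have "\<not> num_iterations p \<le> 0"
      using assms by (subst num_iterations_le_iff) auto
    then show ?thesis
      by (simp add: l_def)
  qed
  moreover have "inj_on T {1, 2, 3}"
    using assms by (auto simp: T_def inj_on_def)
  ultimately have "invariant p q [] S T"
    by (auto simp: invariant_def mediated_modulo_def T_def l_def)
  moreover have "represents (init_state p q) S T"
    by (auto simp: represents_def init_state_def S_def T_def l_def)
  ultimately show ?thesis
    by blast
qed

text \<open>
  Every run, whatever pairs it chooses, is the image of an integer computation; in particular the
  rational divisions by 2 never leave the integers.
\<close>

lemma partial_run_invariant:
  assumes "partial_run p q xs \<sigma>" and pq: "0 < q" "q < p" "coprime p q"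
  shows "\<exists>ys S T. xs = map of_int ys \<and> represents \<sigma> S T \<and> invariant p q ys S T"
  using assms(1)
proof induction
  case start
  show ?case
    using invariant_init[OF pq] by auto
next
  case (iterate xs \<sigma> x \<sigma>')
  obtain ys S T where ys: "xs = map of_int ys" and rep: "represents \<sigma> S T"
    and inv: "invariant p q ys S T"
    using iterate.IH by blast
  have len: "length ys < num_iterations p"
    using iterate.hyps(2) ys by simp
  from iterate.hyps(3) show ?case
  proof cases
    case (1 i j r s t)
    note ijr = \<open>{i, j, r} = {1, 2, 3}\<close>
    have "i \<in> {1, 2, 3}" "j \<in> {1, 2, 3}" "r \<in> {1, 2, 3}"
      using ijr by blast+
    then have reg: "s i = of_int (S i)" "s j = of_int (S j)" "s r = of_int (S r)"
      "t i = of_int (T i)" "t j = of_int (T j)"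
      using rep 1 by (auto simp: represents_def)
    have odd: "odd (S i)" "odd (S j)" and le: "S i \<le> S j"
      using 1 reg by auto
    define S' where "S' = S(j := (S j - S i) div 2, r := S r div 2)"
    define T' where "T' = T(i := (T i + T j) div 2)"
    have inv': "invariant p q (ys @ [(T i + T j) div 2]) S' T'"
      using invariant_step[OF inv pq len ijr odd le] unfolding S'_def T'_def .
    have "balanced q (Suc (num_iterations p - Suc (length ys))) S T"
      using inv len by (simp add: invariant_def Suc_diff_Suc)
    note even = balanced_step(1,2)[OF this ijr odd le]
    have "even (S j - S i)"
      using odd by simp
    then have half: "(s j - s i) / 2 = of_int ((S j - S i) div 2)"
      "s r / 2 = of_int (S r div 2)" "x = of_int ((T i + T j) div 2)"
      using even reg \<open>x = (t i + t j) / 2\<close> by (simp_all add: of_int_div)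
    have "\<sigma>' = (s(j := of_int ((S j - S i) div 2), r := of_int (S r div 2)),
        t(i := of_int ((T i + T j) div 2)))"
      using \<open>\<sigma>' = _\<close> unfolding half .
    then have "represents \<sigma>' S' T'"
      using rep \<open>\<sigma> = (s, t)\<close> unfolding represents_def S'_def T'_def
      by (simp del: insert_iff ball_simps)
    moreover have "xs @ [x] = map of_int (ys @ [(T i + T j) div 2])"
      by (simp add: ys half(3))
    ultimately show ?thesis
      using inv' by blast
  qed
qed

section \<open>Progress and minimality\<close>

lemma partial_run_progress:
  assumes "partial_run p q xs \<sigma>" and "length xs < num_iterations p"
    and "0 < q" "q < p" "coprime p q"
  shows "\<exists>x \<sigma>'. iteration \<sigma> x \<sigma>'"
proof -
  obtain ys S T where ys: "xs = map of_int ys" and rep: "represents \<sigma> S T"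
    and inv: "invariant p q ys S T"
    using partial_run_invariant assms by blast
  have "balanced q (Suc (num_iterations p - Suc (length ys))) S T"
    using inv assms(2) ys by (simp add: invariant_def Suc_diff_Suc)
  then obtain i j r where ijr: "{i, j, r} = {1, 2, 3}"
    and S: "odd (S i)" "odd (S j)" "S i \<le> S j"
    by (rule balanced_odd_pair)
  have "i \<in> {1, 2, 3}" "j \<in> {1, 2, 3}"
    using ijr by blast+
  then have "fst \<sigma> i = of_int (S i)" "fst \<sigma> j = of_int (S j)"
    using rep by (auto simp: represents_def)
  then have "iteration (fst \<sigma>, snd \<sigma>) ((snd \<sigma> i + snd \<sigma> j) / 2)
      ((fst \<sigma>)(j := (fst \<sigma> j - fst \<sigma> i) / 2, r := fst \<sigma> r / 2),
       (snd \<sigma>)(i := (snd \<sigma> i + snd \<sigma> j) / 2))"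
    using S by (intro iteration.intros[OF ijr index_triple_distinct(1)[OF ijr]]) auto
  then show ?thesis
    by auto
qed

lemma partial_run_exists:
  assumes "n \<le> num_iterations p" and "0 < q" "q < p" "coprime p q"
  shows "\<exists>xs \<sigma>. partial_run p q xs \<sigma> \<and> length xs = n"
  using assms(1)
proof (induction n)
  case 0
  show ?case
    using partial_run.start[of p q] by (metis list.size(3))
next
  case (Suc n)
  then obtain xs \<sigma> where run: "partial_run p q xs \<sigma>" "length xs = n"
    by auto
  obtain x \<sigma>' where "iteration \<sigma> x \<sigma>'"
    using partial_run_progress[OF run(1)] run(2) Suc.prems assms by auto
  then have "partial_run p q (xs @ [x]) \<sigma>'"
    using run Suc.prems by (auto intro: partial_run.iterate)
  then show ?case
    using run(2) by (metis length_append_singleton)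
qed

text \<open>
  The outputs form a \<open>(p, q)\<close>-mediated sequence with at most \<open>num_iterations p\<close> elements, which is
  the lower bound for all of them.
\<close>

lemma returns_minimum:
  assumes "returns p q Q" and pq: "0 < q" "q < p" "coprime p q"
  shows "\<exists>A. Q = rat_of_int ` A \<and> minimum_mediated_seq p q A"
proof -
  obtain xs \<sigma> where run: "partial_run p q xs \<sigma>" "length xs = num_iterations p" "Q = set xs"
    using assms(1) unfolding returns_def by blast
  then obtain ys S T where ys: "xs = map of_int ys" and inv: "invariant p q ys S T"
    using partial_run_invariant[OF run(1) pq] by blast
  have "mediated_seq_containing p q (set ys)"
    using inv run(2) ys by (auto simp: invariant_def intro: mediated_moduloD)
  moreover have "card (set ys) \<le> card B"
    if "mediated_seq_containing p q B" "finite B" for B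
  proof -
    have "card (set ys) \<le> num_iterations p"
      using card_length[of ys] run(2) ys by simp
    also have "\<dots> \<le> card B"
      using mediated_seq_card_bound[OF that(2,1) pq(3)] pq by (simp add: num_iterations_le_iff)
    finally show ?thesis .
  qed
  ultimately have "minimum_mediated_seq p q (set ys)"
    by (auto simp: minimum_mediated_seq_def)
  then show ?thesis
    using run(3) ys by auto
qed

theorem theorem18:
  fixes p q :: int
  assumes "0 < q" and "q < p" and "gcd p q = 1"
  shows "algorithm_correct p q"
proof -
  have pq: "0 < q" "q < p" "coprime p q"
    using assms by (simp_all add: coprime_iff_gcd_eq_1)
  show ?thesis
    unfolding algorithm_correct_def
  proof (intro conjI allI impI)
    show "\<exists>Q. returns p q Q"
      using partial_run_exists[OF order.refl pq] unfolding returns_def by blast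
  qed (use partial_run_progress[OF _ _ pq] returns_minimum[OF _ pq] in blast)+
qed

end
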